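(* For all $n\ge0$ and $\theta\in[-1,0]$, $$p_n^{-\theta}(\theta)=\frac{J_{n+2}(\theta)}{(n+1)!}.$$
   Context: For $a\in(-1,\infty)$ and $\theta\in\mathbb R$, let $X_1,X_2,\ldots$ be i.i.d. random variables uniformly distributed on $[-a,1]$. Set $p_0^a(\theta):=1$ and, for $n\ge1$, $$p_n^a(\theta):=\mathbb P(X_2\ge\theta X_1,\,X_3\ge\theta X_2,\,\ldots,\,X_{n+1}\ge\theta X_n).$$ Here $p_n^{-\theta}(\theta)$ is $p_n^a(\theta)$ with $a=-\theta$. The Mallows–Riordan polynomials $J_n(\theta)$, $n\ge1$, are the polynomials in $\theta$ defined by the identity of formal power series in $z$ $$\log\left(\sum_{n=0}^\infty\theta^{n(n-1)/2}\frac{z^n}{n!}\right)=\sum_{n=1}^\infty(\theta-1)^{n-1}J_n(\theta)\frac{z^n}{n!}.$$ *)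

theory Defs
  imports "HOL-Probability.Probability" "HOL-Computational_Algebra.Computational_Algebra"
begin

unbundle no vec_syntax

text \<open>Sequences are indexed as $X_1, X_2, \ldots$; the value \<open>X 0\<close> is unconstrained and
  never used.\<close>

definition iid_uniform :: "real \<Rightarrow> 'w measure \<Rightarrow> (nat \<Rightarrow> 'w \<Rightarrow> real) \<Rightarrow> bool" where
  "iid_uniform a M X \<longleftrightarrow>
     prob_space M \<and> prob_space.indep_vars M (\<lambda>_. borel) X {1..} \<and>
     (\<forall>i\<ge>1. distr M borel (X i) = uniform_measure lborel {-a..1})"

definition persistence_prob :: "'w measure \<Rightarrow> (nat \<Rightarrow> 'w \<Rightarrow> real) \<Rightarrow> nat \<Rightarrow> real \<Rightarrow> real" where
  "persistence_prob M X n \<theta> =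
     (if n = 0 then 1
      else measure M {\<omega> \<in> space M. \<forall>i\<in>{1..n}. X (i + 1) \<omega> \<ge> \<theta> * X i \<omega>})"

lemma iid_uniform_exists:
  fixes a :: real
  assumes "a > -1"
  shows "iid_uniform a (PiM UNIV (\<lambda>_. uniform_measure lborel {-a..1})) (\<lambda>i \<omega>. \<omega> i)"
proof -
  let ?U = "uniform_measure lborel {-a..1}"
  let ?P = "PiM UNIV (\<lambda>_::nat. ?U)"
  interpret U: prob_space ?U
    by (rule prob_space_uniform_measure) (use assms in auto)
  interpret P: prob_space ?P
    by (rule prob_space_PiM) (rule U.prob_space_axioms)
  have comp: "distr ?P borel (\<lambda>\<omega>. \<omega> i) = ?U" for i
  proof -
    have "distr ?P borel (\<lambda>\<omega>. \<omega> i) = distr ?P ?U (\<lambda>\<omega>. \<omega> i)"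
      by (rule distr_cong) auto
    also have "\<dots> = ?U"
      by (rule distr_PiM_component) (auto intro: U.prob_space_axioms)
    finally show ?thesis .
  qed
  have meas: "P.random_variable borel (\<lambda>\<omega>. \<omega> i)" for i
    using measurable_component_singleton[of i UNIV "\<lambda>_. ?U"] by simp
  have "P.indep_vars (\<lambda>_. borel) (\<lambda>i \<omega>. \<omega> i) UNIV"
  proof (subst P.indep_vars_iff_distr_eq_PiM)
    have "distr ?P (PiM UNIV (\<lambda>_. borel)) (\<lambda>x. \<lambda>i\<in>UNIV. x i) = distr ?P ?P (\<lambda>x. x)"
      by (rule distr_cong) (auto intro!: sets_PiM_cong)
    then show "distr ?P (PiM UNIV (\<lambda>_. borel)) (\<lambda>x. \<lambda>i\<in>UNIV. x i)
        = PiM UNIV (\<lambda>i. distr ?P borel (\<lambda>\<omega>. \<omega> i))"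
      by (simp add: comp distr_id)
  qed (use meas in auto)
  then have "P.indep_vars (\<lambda>_. borel) (\<lambda>i \<omega>. \<omega> i) {1..}"
    by (rule P.indep_vars_subset) auto
  then show ?thesis
    unfolding iid_uniform_def using P.prob_space_axioms comp by auto
qed

text \<open>The indeterminate \<open>\<theta>\<close> is the variable of \<open>real poly\<close>, and \<open>z\<close> is the
  variable of the power series. Since \<^const>\<open>fps_ln\<close> requires coefficients in a field,
  the series $\log(1+z)$ is embedded into \<open>real poly fps\<close> coefficientwise.\<close>

definition fps_ln_poly :: "real poly fps" where
  "fps_ln_poly = Abs_fps (\<lambda>k. [: fps_ln 1 $ k :])"

definition fps_log :: "real poly fps \<Rightarrow> real poly fps" where
  "fps_log F = fps_ln_poly oo (F - 1)"

definition mr_series :: "real poly fps" where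
  "mr_series = Abs_fps (\<lambda>n. smult (1 / fact n) (monom 1 (n * (n - 1) div 2)))"

definition mallows_riordan_identity :: "(nat \<Rightarrow> real poly) \<Rightarrow> bool" where
  "mallows_riordan_identity J \<longleftrightarrow>
     fps_log mr_series =
       Abs_fps (\<lambda>n. if n = 0 then 0 else smult (1 / fact n) ([:-1, 1:] ^ (n - 1) * J n))"

text \<open>The polynomials are only defined for $n \ge 1$; the junk value at \<open>0\<close> is fixed so that
  the description is definite.\<close>

definition mallows_riordan :: "nat \<Rightarrow> real poly" where
  "mallows_riordan = (THE J. J 0 = 0 \<and> mallows_riordan_identity J)"

lemma fps_ln_poly_deriv: "fps_deriv fps_ln_poly * (1 + fps_X) = 1"
proof (rule fps_ext)
  fix n
  show "(fps_deriv fps_ln_poly * (1 + fps_X)) $ n = (1 :: real poly fps) $ n"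
  proof (cases n)
    case 0
    then show ?thesis
      by (simp add: fps_ln_poly_def fps_ln_nth one_pCons)
  next
    case (Suc m)
    have A: "of_nat k * [:c:] = [:of_nat k * c:]" for k and c :: real
      by (simp add: of_nat_poly)
    have B: "fps_deriv fps_ln_poly $ k = [:(-1) ^ k:]" for k
      unfolding fps_ln_poly_def fps_deriv_nth fps_nth_Abs_fps A
      by (simp add: fps_ln_nth A del: of_nat_Suc of_nat_add)
    show ?thesis
      using Suc by (simp add: distrib_left B del: fps_deriv_nth)
  qed
qed

lemma mr_series_0: "mr_series $ 0 = 1"
  by (simp add: mr_series_def monom_0 one_pCons)

lemma fps_log_deriv:
  assumes "F $ 0 = 1"
  shows "fps_deriv (fps_log F) * F = fps_deriv F"
proof -
  have z: "(F - 1) $ 0 = 0" using assms by simp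
  have "(fps_deriv fps_ln_poly oo (F - 1)) * F
      = (fps_deriv fps_ln_poly oo (F - 1)) * ((1 + fps_X) oo (F - 1))"
    by (simp only: fps_compose_add_distrib fps_compose_1 fps_X_fps_compose_startby0[OF z]) simp
  also have "\<dots> = (fps_deriv fps_ln_poly * (1 + fps_X)) oo (F - 1)"
    by (rule fps_compose_mult_distrib[OF z, symmetric])
  also have "\<dots> = 1" by (simp add: fps_ln_poly_deriv)
  finally have *: "(fps_deriv fps_ln_poly oo (F - 1)) * F = 1" .
  have "fps_deriv (fps_log F) * F
      = ((fps_deriv fps_ln_poly oo (F - 1)) * F) * fps_deriv F"
    unfolding fps_log_def fps_compose_deriv[OF z] by (simp add: mult_ac)
  then show ?thesis by (simp add: *)
qed

definition fps_scale :: "'a::comm_ring_1 \<Rightarrow> 'a fps \<Rightarrow> 'a fps" where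
  "fps_scale t F = Abs_fps (\<lambda>n. t ^ n * F $ n)"

lemma fps_scale_nth [simp]: "fps_scale t F $ n = t ^ n * F $ n"
  by (simp add: fps_scale_def)

lemma fps_scale_mult: "fps_scale t (F * G) = fps_scale t F * fps_scale t G"
proof (rule fps_ext)
  fix n
  have "t ^ n * (F $ i * G $ (n - i)) = t ^ i * F $ i * (t ^ (n - i) * G $ (n - i))" if "i \<le> n" for i
  proof -
    have "t ^ n = t ^ i * t ^ (n - i)" using that by (simp flip: power_add)
    then show ?thesis by (simp add: mult_ac)
  qed
  then show "fps_scale t (F * G) $ n = (fps_scale t F * fps_scale t G) $ n"
    by (simp add: fps_mult_nth sum_distrib_left)
qed

lemma fps_scale_deriv:
  "fps_deriv (fps_scale t F) = fps_const t * fps_scale t (fps_deriv F)"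
  by (rule fps_ext) (simp add: mult_ac)

lemma mr_series_deriv: "fps_deriv mr_series = fps_scale [:0, 1:] mr_series"
proof (rule fps_ext)
  fix n
  have e: "(n + n * n) div 2 = n + n * (n - Suc 0) div 2"
  proof -
    have "n + n * n = n * 2 + n * (n - 1)"
      by (cases n) (auto simp: algebra_simps)
    then show ?thesis by simp
  qed
  have "[:0, 1:] ^ n = (monom 1 n :: real poly)"
    by (simp add: monom_altdef)
  moreover have "of_nat (Suc n) * smult c (monom 1 k) = smult (of_nat (Suc n) * c) (monom 1 k)"
    for c :: real and k
    by (simp add: of_nat_poly mult.commute del: of_nat_Suc)
  ultimately show "fps_deriv mr_series $ n = fps_scale [:0, 1:] mr_series $ n"
    by (simp add: mr_series_def mult_monom e smult_monom field_simps del: of_nat_Suc mult_Suc)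
qed

lemma mr_log_deriv_dvd: "[:-1, 1:] ^ n dvd fps_deriv (fps_log mr_series) $ n"
proof -
  define t :: "real poly" where "t = [:0, 1:]"
  define F where "F = mr_series"
  define E where "E = fps_deriv (fps_log F)"
  have F0: "F $ 0 = 1" by (simp add: F_def mr_series_0)
  then have Fnz: "F \<noteq> 0" by auto
  have F': "fps_deriv F = fps_scale t F" by (simp add: F_def t_def mr_series_deriv)
  have EF: "E * F = fps_scale t F"
    using fps_log_deriv[OF F0] F' by (simp add: E_def)
  have "fps_deriv (E * F) = fps_const t * fps_scale t (fps_scale t F)"
    by (simp only: EF fps_scale_deriv F')
  also have "fps_scale t (fps_scale t F) = fps_scale t E * (E * F)"
    by (metis EF fps_scale_mult)
  finally have 1: "fps_deriv (E * F) = fps_const t * (fps_scale t E * (E * F))" .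
  have "fps_deriv (E * F) = fps_deriv E * F + E * (E * F)"
    by (subst fps_deriv_mult) (simp only: F' EF add.commute)
  with 1 have "fps_deriv E * F + E * (E * F) = fps_const t * (fps_scale t E * (E * F))"
    by simp
  then have "(fps_deriv E + E * E - fps_const t * fps_scale t E * E) * F = 0"
    by (simp add: algebra_simps)
  with Fnz have "fps_deriv E + E * E - fps_const t * fps_scale t E * E = 0" by simp
  then have E': "fps_deriv E = (fps_const t * fps_scale t E - E) * E"
    by (simp add: algebra_simps)
  have "[:-1, 1:] ^ n dvd E $ n" for n
  proof (induction n rule: less_induct)
    case (less n)
    show ?case
    proof (cases n)
      case 0
      then show ?thesis by simp
    next
      case (Suc m)
      have y: "[:-1, 1:] dvd t ^ Suc k - 1" for k
        by (simp add: dvd_iff_poly_eq_0 t_def)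
      have "[:-1, 1:] ^ n dvd (fps_const t * fps_scale t E - E) $ k * E $ (m - k)"
        if "k \<le> m" for k
      proof -
        have "(fps_const t * fps_scale t E - E) $ k = (t ^ Suc k - 1) * E $ k"
          by (simp add: algebra_simps)
        moreover have "[:-1, 1:] * [:-1, 1:] ^ k dvd (t ^ Suc k - 1) * E $ k"
          using less[of k] that Suc y by (intro mult_dvd_mono) auto
        moreover have "[:-1, 1:] ^ (m - k) dvd E $ (m - k)"
          using less[of "m - k"] Suc by auto
        ultimately have "([:-1, 1:] * [:-1, 1:] ^ k) * [:-1, 1:] ^ (m - k)
            dvd (fps_const t * fps_scale t E - E) $ k * E $ (m - k)"
          by (metis mult_dvd_mono)
        moreover have "([:-1, 1:] * [:-1, 1:] ^ k) * [:-1, 1:] ^ (m - k) = ([:-1, 1:] :: real poly) ^ n"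
          using that Suc by (metis power_Suc power_add add_Suc le_add_diff_inverse)
        ultimately show ?thesis by simp
      qed
      then have "[:-1, 1:] ^ n dvd ((fps_const t * fps_scale t E - E) * E) $ m"
        unfolding fps_mult_nth by (intro dvd_sum) auto
      then have "[:-1, 1:] ^ n dvd of_nat n * E $ n"
        by (simp add: E'[symmetric] Suc)
      then have "[:-1, 1:] ^ n dvd smult (of_nat n) (E $ n)"
        by (simp add: of_nat_poly)
      then show ?thesis
        using Suc by (simp add: dvd_smult_iff del: of_nat_Suc)
    qed
  qed
  then show ?thesis by (simp only: E_def F_def)
qed

lemma mallows_riordan_ex1: "\<exists>!J. J 0 = 0 \<and> mallows_riordan_identity J"
proof -
  let ?L = "fps_log mr_series"
  have "\<exists>q. n > 0 \<longrightarrow> ?L $ n = smult (1 / fact n) ([:-1, 1:] ^ (n - 1) * q)" for n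
  proof (cases n)
    case (Suc m)
    have "[:-1, 1:] ^ m dvd of_nat n * ?L $ n"
      using mr_log_deriv_dvd[of m] by (simp add: Suc)
    then have "[:-1, 1:] ^ m dvd smult (of_nat n) (?L $ n)"
      by (simp add: of_nat_poly)
    then have "[:-1, 1:] ^ m dvd ?L $ n"
      using Suc by (simp add: dvd_smult_iff del: of_nat_Suc)
    then obtain q where "?L $ n = [:-1, 1:] ^ m * q" by (elim dvdE)
    then have "?L $ n = smult (1 / fact n) ([:-1, 1:] ^ (n - 1) * smult (fact n) q)"
      using Suc by (simp del: fact_Suc)
    then show ?thesis by blast
  qed auto
  then obtain J where J: "n > 0 \<Longrightarrow> ?L $ n = smult (1 / fact n) ([:-1, 1:] ^ (n - 1) * J n)" for n
    by metis
  have L0: "?L $ 0 = 0"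
    by (simp add: fps_log_def fps_ln_poly_def)
  show ?thesis
  proof (rule ex1I)
    show "(J(0 := 0)) 0 = 0 \<and> mallows_riordan_identity (J(0 := 0))"
      unfolding mallows_riordan_identity_def by (auto simp: fps_eq_iff J L0)
  next
    fix K assume K: "K 0 = 0 \<and> mallows_riordan_identity K"
    have "K n = J n" if "n > 0" for n
    proof -
      have "smult (1 / fact n) ([:-1, 1:] ^ (n - 1) * K n) = smult (1 / fact n) ([:-1, 1:] ^ (n - 1) * J n)"
        using K J[OF that] that unfolding mallows_riordan_identity_def by (simp add: fps_eq_iff)
      from arg_cong[OF this, of "smult (fact n)"]
      have "[:-1, 1:] ^ (n - 1) * K n = [:-1, 1:] ^ (n - 1) * J n"
        by (simp only: smult_smult) simp
      then show ?thesis by simp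
    qed
    with K show "K = J(0 := 0)" by auto
  qed
qed

lemma mallows_riordan_identity: "mallows_riordan_identity mallows_riordan"
  using theI'[OF mallows_riordan_ex1] unfolding mallows_riordan_def by blast

end

theory Submission
  imports Defs
begin

text \<open>For $\theta \in [-1,0]$ the variables are uniform on $[\theta,1]$, and this interval is mapped
  into itself by $x \mapsto \theta x$. Hence the condition $y \ge \theta x$ on $y \in [\theta,1]$ always
  means $y \in [\theta x, 1]$, with no truncation at the ends. Let
  $$g_0 = 1, \qquad g_{n+1}(x) = \int_{\theta x}^1 g_n(y)\,dy .$$
  Integrating out the variables from the last one to the first (\<open>nn_integral_chain\<close>,
  \<open>chain_op_uniform\<close>) turns the probability into $(1-\theta)^{-(n+1)} \int_\theta^1 g_n(y)\,dy$.
  The lower limit $\theta$ is $\theta \cdot 1$, so the integral is $g_{n+1}(1)$.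

  Let $E(u) = \sum_n \theta^{n(n-1)/2} u^n/n!$, which satisfies $E'(u) = E(\theta u)$. The generating
  function of the $g_n$ is
  $$\sum_n g_n(x) z^n = \frac{E(-\theta z x)}{E(-z)},$$
  because the right-hand side satisfies $\partial_x G(x) = -\theta z\, G(\theta x)$, and
  its numerator cancels the denominator at the point where $\theta x = 1$, which
  corresponds to an empty range of integration. At $x = 1$ it equals
  $E'(-z)/E(-z) = (\log E)'(-z)$, whose coefficients are
  $(1-\theta)^m J_{m+1}(\theta)/m!$ by the definition of the Mallows--Riordan polynomials
  (\<open>mr_log_deriv_fps\<close>, \<open>chain_poly_1\<close>). The powers of $1-\theta$ cancel.

  The proof works with the coefficients of these series, which are polynomials in $x$ and
  $\theta$, so that $\theta = 0$ needs no separate treatment.\<close>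

section \<open>Specialising the generating function at a real parameter\<close>

text \<open>Coefficientwise evaluation of the indeterminate $\theta$ at a real number.\<close>

definition eval_fps :: "real \<Rightarrow> real poly fps \<Rightarrow> real fps" where
  "eval_fps \<theta> F = Abs_fps (\<lambda>n. poly (F $ n) \<theta>)"

lemma eval_fps_nth [simp]: "eval_fps \<theta> F $ n = poly (F $ n) \<theta>"
  by (simp add: eval_fps_def)

lemma eval_fps_mult: "eval_fps \<theta> (F * G) = eval_fps \<theta> F * eval_fps \<theta> G"
  by (rule fps_ext) (simp add: fps_mult_nth poly_sum)

text \<open>The series $E(u) = \sum_n \theta^{n(n-1)/2} u^n/n!$ for a fixed real $\theta$.\<close>

definition mr_fps :: "real \<Rightarrow> real fps" where
  "mr_fps \<theta> = eval_fps \<theta> mr_series"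

lemma mr_fps_nth: "mr_fps \<theta> $ k = \<theta> ^ (k * (k - 1) div 2) / fact k"
  by (simp add: mr_fps_def mr_series_def poly_monom)

lemma mr_log_deriv_nth:
  "fps_deriv (fps_log mr_series) $ m = smult (1 / fact m) ([:-1, 1:] ^ m * mallows_riordan (Suc m))"
proof -
  have "fps_log mr_series $ Suc m
      = smult (1 / fact (Suc m)) ([:-1, 1:] ^ m * mallows_riordan (Suc m))"
    using mallows_riordan_identity unfolding mallows_riordan_identity_def
    by (simp add: fps_eq_iff del: fact_Suc)
  then show ?thesis
    by (simp add: of_nat_poly field_simps del: of_nat_Suc)
qed

text \<open>This is $(\log E)'(-z) \cdot E(-z) = E(-\theta z)$. The sign of $z$ turns the factor $(\theta-1)^m$ of
  the defining identity into $(1-\theta)^m$.\<close>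

lemma mr_log_deriv_fps:
  "Abs_fps (\<lambda>m. (1 - \<theta>) ^ m * poly (mallows_riordan (Suc m)) \<theta> / fact m) * fps_scale (-1) (mr_fps \<theta>)
     = fps_scale (-\<theta>) (mr_fps \<theta>)"
proof -
  define D where "D = eval_fps \<theta> (fps_deriv (fps_log mr_series))"
  have "fps_deriv (fps_log mr_series) * mr_series = fps_scale [:0, 1:] mr_series"
    using fps_log_deriv[OF mr_series_0] by (simp only: mr_series_deriv)
  then have "eval_fps \<theta> (fps_deriv (fps_log mr_series) * mr_series) = eval_fps \<theta> (fps_scale [:0, 1:] mr_series)"
    by simp
  then have "D * mr_fps \<theta> = fps_scale \<theta> (mr_fps \<theta>)"
    by (simp only: eval_fps_mult D_def mr_fps_def) (simp add: fps_eq_iff)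
  then have "fps_scale (-1) D * fps_scale (-1) (mr_fps \<theta>) = fps_scale (-1) (fps_scale \<theta> (mr_fps \<theta>))"
    by (simp only: fps_scale_mult[symmetric])
  moreover have "fps_scale (-1) (fps_scale \<theta> (mr_fps \<theta>)) = fps_scale (-\<theta>) (mr_fps \<theta>)"
    by (rule fps_ext) (simp add: power_mult_distrib[symmetric] mult.assoc[symmetric])
  moreover have "fps_scale (-1) D = Abs_fps (\<lambda>m. (1 - \<theta>) ^ m * poly (mallows_riordan (Suc m)) \<theta> / fact m)"
    by (rule fps_ext) (simp add: D_def mr_log_deriv_nth power_mult_distrib[symmetric] mult.assoc[symmetric]
      del: fps_deriv_nth)
  ultimately show ?thesis by simp
qed

section \<open>Iterated integrals\<close>

text \<open>The coefficients of $1/E(-z)$.\<close>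

definition inv_coeff :: "real \<Rightarrow> nat \<Rightarrow> real" where
  "inv_coeff \<theta> n = inverse (fps_scale (-1) (mr_fps \<theta>)) $ n"

text \<open>The polynomial $g_n(x)$, defined as the coefficient of $z^n$ in $E(-\theta z x)/E(-z)$; that it is
  the iterated integral follows from \<open>chain_poly_Suc\<close> and \<open>chain_antideriv_deriv\<close>.\<close>

definition chain_poly :: "real \<Rightarrow> nat \<Rightarrow> real \<Rightarrow> real" where
  "chain_poly \<theta> n x = (\<Sum>k\<le>n. inv_coeff \<theta> (n - k) * (mr_fps \<theta> $ k * (-\<theta> * x) ^ k))"

text \<open>The antiderivative of $g_n$ vanishing at 0. It is written with the coefficients of $E$ in degree
  $k+1$, which avoids a division by $\theta$.\<close>

definition chain_antideriv :: "real \<Rightarrow> nat \<Rightarrow> real \<Rightarrow> real" where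
  "chain_antideriv \<theta> n y = - (\<Sum>k\<le>n. inv_coeff \<theta> (n - k) * (mr_fps \<theta> $ Suc k * (- y) ^ Suc k))"

lemma mr_fps_inverse:
  "inverse (fps_scale (-1) (mr_fps \<theta>)) * fps_scale (-1) (mr_fps \<theta>) = 1"
  by (rule inverse_mult_eq_1) (simp add: mr_fps_nth)

lemma inv_coeff_0: "inv_coeff \<theta> 0 = 1"
  by (simp add: inv_coeff_def mr_fps_nth)

lemma chain_poly_0: "chain_poly \<theta> 0 x = 1"
  by (simp add: chain_poly_def inv_coeff_0 mr_fps_nth)

lemma chain_poly_1: "chain_poly \<theta> n 1 = (1 - \<theta>) ^ n * poly (mallows_riordan (Suc n)) \<theta> / fact n"
proof -
  let ?A = "Abs_fps (\<lambda>m. (1 - \<theta>) ^ m * poly (mallows_riordan (Suc m)) \<theta> / fact m)"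
  have "?A = ?A * (inverse (fps_scale (-1) (mr_fps \<theta>)) * fps_scale (-1) (mr_fps \<theta>))"
    by (simp only: mr_fps_inverse) simp
  also have "\<dots> = fps_scale (-\<theta>) (mr_fps \<theta>) * inverse (fps_scale (-1) (mr_fps \<theta>))"
    by (simp only: mr_log_deriv_fps[symmetric] mult_ac)
  finally have "?A $ n = (fps_scale (-\<theta>) (mr_fps \<theta>) * inverse (fps_scale (-1) (mr_fps \<theta>))) $ n"
    by simp
  then show ?thesis
    by (simp add: chain_poly_def inv_coeff_def fps_mult_nth mult_ac atLeast0AtMost)
qed

text \<open>This encodes the boundary condition at $\theta x = 1$: the coefficient of $z^{n+1}$ in
  $E(-z) \cdot (1/E(-z))$ is zero.\<close>

lemma chain_antideriv_1: "chain_antideriv \<theta> n 1 = inv_coeff \<theta> (Suc n)"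
proof -
  have "(fps_scale (-1) (mr_fps \<theta>) * inverse (fps_scale (-1) (mr_fps \<theta>))) $ Suc n = 0"
    using mr_fps_inverse[of \<theta>] by (simp add: mult.commute)
  then have "(\<Sum>k\<le>Suc n. (-1) ^ k * mr_fps \<theta> $ k * inv_coeff \<theta> (Suc n - k)) = 0"
    by (simp only: fps_mult_nth fps_scale_nth inv_coeff_def atLeast0AtMost)
  then show ?thesis
    unfolding sum.atMost_Suc_shift
    by (simp add: chain_antideriv_def mr_fps_nth mult_ac)
qed

lemma chain_poly_Suc:
  "chain_poly \<theta> (Suc n) x = chain_antideriv \<theta> n 1 - chain_antideriv \<theta> n (\<theta> * x)"
  unfolding chain_poly_def sum.atMost_Suc_shift chain_antideriv_1
  by (simp add: chain_antideriv_def mr_fps_nth)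

text \<open>The equation $E'(u) = E(\theta u)$ for coefficients.\<close>

lemma mr_fps_Suc: "real (Suc k) * mr_fps \<theta> $ Suc k = \<theta> ^ k * mr_fps \<theta> $ k"
proof -
  have "Suc k * (Suc k - 1) div 2 = k + k * (k - 1) div 2"
  proof -
    have "Suc k * (Suc k - 1) = k * 2 + k * (k - 1)"
      by (cases k) (auto simp: algebra_simps)
    then show ?thesis by simp
  qed
  then show ?thesis
    by (simp add: mr_fps_nth power_add field_simps del: of_nat_Suc mult_Suc)
qed

lemma chain_antideriv_deriv:
  "(chain_antideriv \<theta> n has_real_derivative chain_poly \<theta> n y) (at y)"
proof -
  have "((\<lambda>y. inv_coeff \<theta> (n - k) * (mr_fps \<theta> $ Suc k * (- y) ^ Suc k)) has_real_derivative
     - (inv_coeff \<theta> (n - k) * (mr_fps \<theta> $ k * (-\<theta> * y) ^ k))) (at y)" for k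
  proof -
    have "((\<lambda>y. inv_coeff \<theta> (n - k) * (mr_fps \<theta> $ Suc k * (- y) ^ Suc k)) has_real_derivative
       - (inv_coeff \<theta> (n - k) * ((real (Suc k) * mr_fps \<theta> $ Suc k) * (- y) ^ k))) (at y)"
      by (auto intro!: derivative_eq_intros simp del: of_nat_Suc power_Suc)
    moreover have "(-\<theta> * y) ^ k = \<theta> ^ k * (- y) ^ k"
      by (simp flip: power_mult_distrib)
    ultimately show ?thesis
      by (simp only: mr_fps_Suc mult_ac)
  qed
  then have "((\<lambda>y. \<Sum>k\<le>n. inv_coeff \<theta> (n - k) * (mr_fps \<theta> $ Suc k * (- y) ^ Suc k))
      has_real_derivative (\<Sum>k\<le>n. - (inv_coeff \<theta> (n - k) * (mr_fps \<theta> $ k * (-\<theta> * y) ^ k)))) (at y)"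
    by (intro DERIV_sum) auto
  from DERIV_minus[OF this] show ?thesis
    by (simp add: chain_antideriv_def[abs_def] chain_poly_def sum_negf)
qed

lemma scaled_mem:
  assumes "\<theta> \<in> {-1..0::real}" "x \<in> {\<theta>..1}"
  shows "\<theta> * x \<in> {\<theta>..1}"
proof -
  have "\<theta> * 1 \<le> \<theta> * x" using assms by (intro mult_left_mono_neg) auto
  moreover have "\<theta> * x \<le> \<theta> * \<theta>" using assms by (intro mult_left_mono_neg) auto
  moreover have "\<theta> * \<theta> \<le> 1" using mult_mono[of "-\<theta>" 1 "-\<theta>" 1] assms by auto
  ultimately show ?thesis by auto
qed

lemma chain_poly_nonneg:
  assumes "\<theta> \<in> {-1..0::real}" "x \<in> {\<theta>..1}"
  shows "chain_poly \<theta> n x \<ge> 0"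
  using assms(2)
proof (induction n arbitrary: x)
  case (Suc n)
  have mem: "\<theta> * x \<in> {\<theta>..1}" using scaled_mem assms(1) Suc.prems by blast
  have "chain_antideriv \<theta> n (\<theta> * x) \<le> chain_antideriv \<theta> n 1"
  proof (rule DERIV_nonneg_imp_nondecreasing[where f = "chain_antideriv \<theta> n"])
    show "\<theta> * x \<le> 1" using mem by simp
    show "\<exists>d. DERIV (chain_antideriv \<theta> n) y :> d \<and> d \<ge> 0" if "\<theta> * x \<le> y" "y \<le> 1" for y
    proof -
      have "y \<in> {\<theta>..1}" using mem that by simp
      then show ?thesis using Suc.IH chain_antideriv_deriv by blast
    qed
  qed
  then show ?case by (simp add: chain_poly_Suc)
qed (simp add: chain_poly_0)

section \<open>The persistence probability as an iterated integral\<close>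

text \<open>One step of the chain: $x \mapsto \mathbb{E}[f(Y);\, Y \ge \theta x]$ for $Y$ with law \<open>N\<close>.\<close>

definition chain_op :: "real measure \<Rightarrow> real \<Rightarrow> (real \<Rightarrow> ennreal) \<Rightarrow> real \<Rightarrow> ennreal" where
  "chain_op N \<theta> f x = (\<integral>\<^sup>+y. indicator {\<theta> * x..} y * f y \<partial>N)"

lemma chain_op_measurable:
  assumes "prob_space N" "sets N = sets borel" "f \<in> borel_measurable borel"
  shows "chain_op N \<theta> f \<in> borel_measurable borel"
proof -
  interpret prob_space N by fact
  have [measurable_cong]: "sets N = sets borel" by fact
  have [measurable]: "f \<in> borel_measurable borel" by fact
  have "(\<lambda>x. \<integral>\<^sup>+y. indicator {(x, y). \<theta> * x \<le> y} (x, y) * f y \<partial>N) \<in> borel_measurable borel"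
    by measurable
  also have "(\<lambda>x. \<integral>\<^sup>+y. indicator {(x, y). \<theta> * x \<le> y} (x, y) * f y \<partial>N) = chain_op N \<theta> f"
    by (auto simp: chain_op_def[abs_def] indicator_def intro!: ext nn_integral_cong)
  finally show ?thesis .
qed

text \<open>Integrating out the last variable, which is independent of all the earlier ones. Only
  independence is used here; the variables may have different laws.\<close>

lemma (in prob_space) nn_integral_chain_step:
  fixes X :: "nat \<Rightarrow> 'a \<Rightarrow> real"
  assumes ind: "indep_vars (\<lambda>_. borel) X {1..}" and [measurable]: "f \<in> borel_measurable borel"
  shows "(\<integral>\<^sup>+\<omega>. indicator {\<omega>. \<forall>i\<in>{1..Suc n}. X (i + 1) \<omega> \<ge> \<theta> * X i \<omega>} \<omega> * f (X (n + 2) \<omega>) \<partial>M)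
    = (\<integral>\<^sup>+\<omega>. indicator {\<omega>. \<forall>i\<in>{1..n}. X (i + 1) \<omega> \<ge> \<theta> * X i \<omega>} \<omega>
         * chain_op (distr M borel (X (n + 2))) \<theta> f (X (n + 1) \<omega>) \<partial>M)"
proof -
  define S where "S = PiM {1..n + 1} (\<lambda>_::nat. borel :: real measure)"
  define Y where "Y = (\<lambda>\<omega>. \<lambda>i\<in>{1..n + 1}. X i \<omega>)"
  define C where "C = (\<lambda>w::nat \<Rightarrow> real. indicator {w. \<forall>i\<in>{1..n}. w (i + 1) \<ge> \<theta> * w i} w :: ennreal)"
  define F where "F = (\<lambda>p. C (fst p) * (indicator {p. snd p \<ge> \<theta> * fst p (n + 1)} p * f (snd p)))"
  let ?Z = "X (n + 2)"
  let ?N = "distr M borel ?Z"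
  have [measurable]: "X i \<in> borel_measurable M" if "i \<ge> 1" for i
    using ind that unfolding indep_vars_def by auto
  have Y[measurable]: "Y \<in> measurable M S"
    unfolding Y_def S_def by (rule measurable_restrict) auto
  have comp[measurable]: "(\<lambda>w. w i) \<in> borel_measurable S" if "i \<in> {1..n + 1}" for i
    unfolding S_def using that by measurable
  \<comment> \<open>Intersecting with \<open>space S\<close> makes the set measurable; the indicators agree on \<open>space S\<close>.\<close>
  have Cm[measurable]: "C \<in> borel_measurable S"
  proof -
    have [measurable]: "Measurable.pred S (\<lambda>w. w (i + 1) \<ge> \<theta> * w i)" if "i \<in> {1..n}" for i
      unfolding pred_def
      by (intro borel_measurable_le borel_measurable_times borel_measurable_const comp) (use that in auto)
    have "{w \<in> space S. \<forall>i\<in>{1..n}. w (i + 1) \<ge> \<theta> * w i} \<in> sets S"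
      by measurable
    then have "indicator {w \<in> space S. \<forall>i\<in>{1..n}. w (i + 1) \<ge> \<theta> * w i} \<in> borel_measurable S"
      by (rule borel_measurable_indicator)
    then show ?thesis
      by (rule measurable_cong[THEN iffD1, rotated]) (auto simp: C_def indicator_def)
  qed
  have Fm[measurable]: "F \<in> borel_measurable (S \<Otimes>\<^sub>M borel)"
  proof -
    have [measurable]: "(\<lambda>p. fst p (n + 1)) \<in> borel_measurable (S \<Otimes>\<^sub>M (borel :: real measure))"
      by (rule measurable_compose[OF measurable_fst comp]) auto
    have "{p \<in> space (S \<Otimes>\<^sub>M borel). snd p \<ge> \<theta> * fst p (n + 1)} \<in> sets (S \<Otimes>\<^sub>M (borel :: real measure))"
      by measurable
    then have "indicator {p \<in> space (S \<Otimes>\<^sub>M borel). snd p \<ge> \<theta> * fst p (n + 1)} \<in> borel_measurable (S \<Otimes>\<^sub>M (borel :: real measure))"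
      by (rule borel_measurable_indicator)
    then have [measurable]: "(indicator {p. snd p \<ge> \<theta> * fst p (n + 1)} :: _ \<Rightarrow> ennreal) \<in> borel_measurable (S \<Otimes>\<^sub>M (borel :: real measure))"
      by (rule measurable_cong[THEN iffD1, rotated]) (auto simp: indicator_def)
    show ?thesis unfolding F_def by measurable
  qed
  \<comment> \<open>\<^const>\<open>indep_var\<close> requires both variables to have the same type, so \<open>X (n + 2)\<close> is wrapped
    into a family indexed by a singleton.\<close>
  define S' where "S' = PiM {n + 2} (\<lambda>_::nat. borel :: real measure)"
  define W where "W = (\<lambda>\<omega>. \<lambda>i\<in>{n + 2}. X i \<omega>)"
  define G where "G = (\<lambda>p. F (fst p, snd p (n + 2)))"
  have W[measurable]: "W \<in> measurable M S'"
    unfolding W_def S'_def by (rule measurable_restrict) auto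
  have [measurable]: "(\<lambda>v. v (n + 2)) \<in> borel_measurable S'"
    unfolding S'_def by (rule measurable_component_singleton) simp
  have Gm: "G \<in> borel_measurable (S \<Otimes>\<^sub>M S')"
    unfolding G_def by measurable
  have WZ: "W \<omega> (n + 2) = ?Z \<omega>" for \<omega>
    by (simp add: W_def)
  have "indep_var S Y S' W"
    unfolding S_def Y_def S'_def W_def by (rule indep_var_restrict[OF ind]) auto
  then have D: "distr M (S \<Otimes>\<^sub>M S') (\<lambda>\<omega>. (Y \<omega>, W \<omega>)) = distr M S Y \<Otimes>\<^sub>M distr M S' W"
    using indep_var_distribution_eq by metis
  interpret W: prob_space "distr M S' W" by (rule prob_space_distr) simp
  interpret N: prob_space ?N by (rule prob_space_distr) simp
  have Gm': "G \<in> borel_measurable (distr M S Y \<Otimes>\<^sub>M distr M S' W)"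
    using Gm by simp
  have split: "(\<forall>i\<in>{1..Suc n}. X (i + 1) \<omega> \<ge> \<theta> * X i \<omega>)
      \<longleftrightarrow> (\<forall>i\<in>{1..n}. X (i + 1) \<omega> \<ge> \<theta> * X i \<omega>) \<and> X (n + 2) \<omega> \<ge> \<theta> * X (n + 1) \<omega>" for \<omega>
    by (auto simp: atLeastAtMostSuc_conv)
  have CY: "C (Y \<omega>) = indicator {\<omega>. \<forall>i\<in>{1..n}. X (i + 1) \<omega> \<ge> \<theta> * X i \<omega>} \<omega>" for \<omega>
    by (auto simp: C_def Y_def indicator_def)
  have YN: "Y \<omega> (n + 1) = X (n + 1) \<omega>" for \<omega>
    by (simp add: Y_def)
  have "(\<integral>\<^sup>+\<omega>. indicator {\<omega>. \<forall>i\<in>{1..Suc n}. X (i + 1) \<omega> \<ge> \<theta> * X i \<omega>} \<omega> * f (?Z \<omega>) \<partial>M)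
      = (\<integral>\<^sup>+\<omega>. F (Y \<omega>, ?Z \<omega>) \<partial>M)"
    unfolding split F_def fst_conv snd_conv CY
    by (intro nn_integral_cong) (simp add: indicator_def YN del: One_nat_def add_Suc_right)
  also have "\<dots> = (\<integral>\<^sup>+\<omega>. G (Y \<omega>, W \<omega>) \<partial>M)"
    unfolding G_def fst_conv snd_conv WZ ..
  also have "\<dots> = (\<integral>\<^sup>+p. G p \<partial>distr M (S \<Otimes>\<^sub>M S') (\<lambda>\<omega>. (Y \<omega>, W \<omega>)))"
    by (rule nn_integral_distr[symmetric]) (use Gm in measurable)
  also have "\<dots> = (\<integral>\<^sup>+w. (\<integral>\<^sup>+v. G (w, v) \<partial>distr M S' W) \<partial>distr M S Y)"
    unfolding D by (rule W.nn_integral_fst[symmetric]) (rule Gm')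
  also have "\<dots> = (\<integral>\<^sup>+w. (\<integral>\<^sup>+y. F (w, y) \<partial>?N) \<partial>distr M S Y)"
  proof (rule nn_integral_cong)
    fix w assume "w \<in> space (distr M S Y)"
    then have "w \<in> space S" by simp
    have "(\<integral>\<^sup>+v. G (w, v) \<partial>distr M S' W) = (\<integral>\<^sup>+\<omega>. G (w, W \<omega>) \<partial>M)"
      by (rule nn_integral_distr[OF W]) (simp add: measurable_Pair2[OF Gm] \<open>w \<in> space S\<close>)
    also have "\<dots> = (\<integral>\<^sup>+\<omega>. F (w, ?Z \<omega>) \<partial>M)"
      unfolding G_def fst_conv snd_conv WZ ..
    also have "\<dots> = (\<integral>\<^sup>+y. F (w, y) \<partial>?N)"
      by (rule nn_integral_distr[symmetric]) (simp_all add: measurable_Pair2[OF Fm] \<open>w \<in> space S\<close>)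
    finally show "(\<integral>\<^sup>+v. G (w, v) \<partial>distr M S' W) = (\<integral>\<^sup>+y. F (w, y) \<partial>?N)" .
  qed
  also have "\<dots> = (\<integral>\<^sup>+w. C w * chain_op ?N \<theta> f (w (n + 1)) \<partial>distr M S Y)"
  proof (rule nn_integral_cong)
    fix w
    have "(\<integral>\<^sup>+y. F (w, y) \<partial>?N) = (\<integral>\<^sup>+y. C w * (indicator {\<theta> * w (n + 1)..} y * f y) \<partial>?N)"
      by (intro nn_integral_cong) (simp add: F_def indicator_def)
    also have "\<dots> = C w * chain_op ?N \<theta> f (w (n + 1))"
      unfolding chain_op_def by (rule nn_integral_cmult) simp
    finally show "(\<integral>\<^sup>+y. F (w, y) \<partial>?N) = C w * chain_op ?N \<theta> f (w (n + 1))" .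
  qed
  also have "\<dots> = (\<integral>\<^sup>+\<omega>. C (Y \<omega>) * chain_op ?N \<theta> f (Y \<omega> (n + 1)) \<partial>M)"
  proof (rule nn_integral_distr)
    have "chain_op ?N \<theta> f \<in> borel_measurable borel"
      by (rule chain_op_measurable[OF N.prob_space_axioms]) auto
    then have "(\<lambda>w. chain_op ?N \<theta> f (w (n + 1))) \<in> borel_measurable S"
      by (rule measurable_compose[rotated]) (auto intro: comp)
    then show "(\<lambda>w. C w * chain_op ?N \<theta> f (w (n + 1))) \<in> borel_measurable (distr M S Y)"
      by simp
  qed (rule Y)
  finally show ?thesis by (simp only: CY YN)
qed

lemma (in prob_space) nn_integral_chain:
  fixes X :: "nat \<Rightarrow> 'a \<Rightarrow> real"
  assumes ind: "indep_vars (\<lambda>_. borel) X {1..}"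
    and id: "\<And>i. i \<ge> 1 \<Longrightarrow> distr M borel (X i) = N"
    and f: "f \<in> borel_measurable borel"
  shows "(\<integral>\<^sup>+\<omega>. indicator {\<omega>. \<forall>i\<in>{1..n}. X (i + 1) \<omega> \<ge> \<theta> * X i \<omega>} \<omega> * f (X (n + 1) \<omega>) \<partial>M)
    = (\<integral>\<^sup>+x. (chain_op N \<theta> ^^ n) f x \<partial>N)"
proof -
  have Xm: "X i \<in> borel_measurable M" if "i \<ge> 1" for i
    using ind that unfolding indep_vars_def by auto
  have N: "prob_space N" "sets N = sets borel"
    using id[of 1] prob_space_distr[OF Xm[of 1]] by auto
  show ?thesis
    using f
  proof (induction n arbitrary: f)
    case 0
    then have "(\<integral>\<^sup>+\<omega>. f (X 1 \<omega>) \<partial>M) = (\<integral>\<^sup>+x. f x \<partial>distr M borel (X 1))"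
      by (intro nn_integral_distr[symmetric]) (auto intro: Xm)
    then show ?case by (simp add: id)
  next
    case (Suc n)
    show ?case
      using nn_integral_chain_step[OF ind Suc.prems, of n \<theta>] Suc.IH[of "chain_op N \<theta> f"]
      by (simp add: id chain_op_measurable[OF N Suc.prems] funpow_swap1)
  qed
qed

section \<open>The uniform case\<close>

lemma chain_op_uniform:
  assumes \<theta>: "\<theta> \<in> {-1..0::real}" and x: "x \<in> {\<theta>..1}"
  shows "(chain_op (uniform_measure lborel {\<theta>..1}) \<theta> ^^ n) (\<lambda>_. 1) x
    = ennreal (chain_poly \<theta> n x / (1 - \<theta>) ^ n)"
  using x
proof (induction n arbitrary: x)
  case (Suc n)
  let ?T = "chain_op (uniform_measure lborel {\<theta>..1}) \<theta>"
  have mem: "\<theta> * x \<in> {\<theta>..1}" using scaled_mem \<theta> Suc.prems by blast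
  have pos: "1 - \<theta> > 0" using \<theta> by auto
  have meas: "(?T ^^ n) (\<lambda>_. 1) \<in> borel_measurable borel"
  proof (induction n)
    case (Suc n)
    have "prob_space (uniform_measure lborel {\<theta>..1})"
      by (rule prob_space_uniform_measure) (use pos in auto)
    with Suc show ?case by (auto intro: chain_op_measurable)
  qed auto
  have pm: "chain_poly \<theta> n \<in> borel_measurable borel"
    unfolding chain_poly_def[abs_def] by measurable
  have "(?T ^^ Suc n) (\<lambda>_. 1) x = ?T ((?T ^^ n) (\<lambda>_. 1)) x" by simp
  also have "\<dots> = (\<integral>\<^sup>+y. indicator {\<theta> * x..} y * (?T ^^ n) (\<lambda>_. 1) y * indicator {\<theta>..1} y \<partial>lborel)
      / emeasure lborel {\<theta>..1}"
    unfolding chain_op_def using meas[unfolded chain_op_def]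
    by (subst nn_integral_uniform_measure) auto
  also have "(\<integral>\<^sup>+y. indicator {\<theta> * x..} y * (?T ^^ n) (\<lambda>_. 1) y * indicator {\<theta>..1} y \<partial>lborel)
      = (\<integral>\<^sup>+y. ennreal (chain_poly \<theta> n y / (1 - \<theta>) ^ n) * indicator {\<theta> * x..1} y \<partial>lborel)"
    using mem by (intro nn_integral_cong) (auto simp: indicator_def Suc.IH)
  also have "\<dots> = ennreal (chain_antideriv \<theta> n 1 / (1 - \<theta>) ^ n - chain_antideriv \<theta> n (\<theta> * x) / (1 - \<theta>) ^ n)"
  proof (rule nn_integral_FTC_Icc)
    show "((\<lambda>y. chain_antideriv \<theta> n y / (1 - \<theta>) ^ n) has_real_derivative chain_poly \<theta> n y / (1 - \<theta>) ^ n) (at y)" for y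
      by (rule DERIV_cdivide[OF chain_antideriv_deriv])
    show "0 \<le> chain_poly \<theta> n y / (1 - \<theta>) ^ n" if "y \<in> {\<theta> * x..1}" for y
      using that mem pos by (intro divide_nonneg_pos chain_poly_nonneg \<theta>) auto
  qed (use pm mem in auto)
  also have "\<dots> = ennreal (chain_poly \<theta> (Suc n) x / (1 - \<theta>) ^ n)"
    by (simp add: chain_poly_Suc diff_divide_distrib)
  also have "emeasure lborel {\<theta>..1} = ennreal (1 - \<theta>)"
    using pos by simp
  also have "ennreal (chain_poly \<theta> (Suc n) x / (1 - \<theta>) ^ n) / ennreal (1 - \<theta>)
      = ennreal (chain_poly \<theta> (Suc n) x / (1 - \<theta>) ^ Suc n)"
    using pos chain_poly_nonneg[OF \<theta> Suc.prems, of "Suc n"]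
    by (subst divide_ennreal) (auto simp: mult_ac)
  finally show ?case .
qed (simp add: chain_poly_0)

theorem corollary4:
  fixes M :: "'w measure" and X :: "nat \<Rightarrow> 'w \<Rightarrow> real" and \<theta> :: real and n :: nat
  assumes "\<theta> \<in> {-1..0}"
    and "iid_uniform (-\<theta>) M X"
  shows "persistence_prob M X n \<theta> = poly (mallows_riordan (n + 2)) \<theta> / fact (n + 1)"
proof -
  let ?U = "uniform_measure lborel {\<theta>..1}"
  let ?C = "{\<omega> \<in> space M. \<forall>i\<in>{1..n}. X (i + 1) \<omega> \<ge> \<theta> * X i \<omega>}"
  interpret prob_space M using assms(2) by (simp add: iid_uniform_def)
  have ind: "indep_vars (\<lambda>_. borel) X {1..}" and id: "\<And>i. i \<ge> 1 \<Longrightarrow> distr M borel (X i) = ?U"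
    using assms(2) by (auto simp: iid_uniform_def)
  have [measurable]: "X i \<in> borel_measurable M" if "i \<ge> 1" for i
    using ind that unfolding indep_vars_def by auto
  have C: "?C \<in> sets M" by measurable
  have pos: "1 - \<theta> > 0" using assms(1) by auto
  have one: "1 \<in> {\<theta>..1}" using pos by auto
  have "emeasure M ?C = (\<integral>\<^sup>+\<omega>. indicator ?C \<omega> \<partial>M)"
    using C by simp
  also have "\<dots> = (\<integral>\<^sup>+\<omega>. indicator {\<omega>. \<forall>i\<in>{1..n}. X (i + 1) \<omega> \<ge> \<theta> * X i \<omega>} \<omega> * 1 \<partial>M)"
    by (intro nn_integral_cong) (auto simp: indicator_def)
  also have "\<dots> = (\<integral>\<^sup>+x. (chain_op ?U \<theta> ^^ n) (\<lambda>_. 1) x \<partial>?U)"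
    using nn_integral_chain[OF ind id, of "\<lambda>_. 1"] by simp
  \<comment> \<open>The constraint \<open>\<theta> * 1 \<le> y\<close> holds almost surely, so the integral against the law of the first
    variable is one more step of the chain, started at 1.\<close>
  also have "\<dots> = chain_op ?U \<theta> ((chain_op ?U \<theta> ^^ n) (\<lambda>_. 1)) 1"
    unfolding chain_op_def[of _ _ "(chain_op ?U \<theta> ^^ n) (\<lambda>_. 1)"]
    by (intro nn_integral_cong_AE AE_uniform_measureI) (auto simp: indicator_def)
  also have "\<dots> = ennreal (chain_poly \<theta> (n + 1) 1 / (1 - \<theta>) ^ (n + 1))"
    using chain_op_uniform[OF assms(1) one, of "n + 1"] by simp
  finally have "measure M ?C = chain_poly \<theta> (n + 1) 1 / (1 - \<theta>) ^ (n + 1)"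
    using pos chain_poly_nonneg[OF assms(1) one, of "n + 1"]
    by (intro measure_eq_emeasure_eq_ennreal) auto
  also have "\<dots> = poly (mallows_riordan (n + 2)) \<theta> / fact (n + 1)"
    using pos unfolding chain_poly_1 by (simp del: power_Suc fact_Suc)
  finally have *: "measure M ?C = poly (mallows_riordan (n + 2)) \<theta> / fact (n + 1)" .
  moreover have "persistence_prob M X n \<theta> = measure M ?C"
    by (cases "n = 0") (simp_all add: persistence_prob_def prob_space)
  ultimately show ?thesis by simp
qed

end
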